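(* (1) The functor of smallification $sm:\mathbf{LSS}\to\mathbf{SS}$ defined by $sm(X,\mathcal{L}_X)=(X,\mathcal{L}_X^o)$ (and leaving underlying mappings unchanged) is a concrete reflector. (2) After identification of each locally small space $(X,\mathcal{L}_X)$ with the generalized topological space $(X,\mathcal{L}_X^o,EF(\mathcal{L}_X^o,\mathcal{L}_X))$, this functor is the restriction of the smallification functor $sm:\mathbf{GTS}\to\mathbf{SS}$ given by $sm(X,Op_X,Cov_X)=(X,Op_X,EssFin(Op_X))$.
   Context: A locally small space is a pair $(X,\mathcal{L}_X)$ with $X$ a set and $\mathcal{L}_X\subseteq\mathcal{P}(X)$ such that $\emptyset\in\mathcal{L}_X$, $L\cap M,L\cup M\in\mathcal{L}_X$ for all $L,M\in\mathcal{L}_X$, and $\bigcup\mathcal{L}_X=X$. For $\mathcal{A}\subseteq\mathcal{P}(X)$, $\mathcal{A}^o=\{V\subseteq X:V\cap A\in\mathcal{A}\ \forall A\in\mathcal{A}\}$. A mapping $f:X\to Y$ between locally small spaces is bounded if each $L\in\mathcal{L}_X$ is contained in $f^{-1}(M)$ for some $M\in\mathcal{L}_Y$, and continuous if $f^{-1}(M)\in\mathcal{L}_X^o$ for all $M\in\mathcal{L}_Y$. $\mathbf{LSS}$ is the category of locally small spaces and bounded continuous mappings. A locally small space is small if $X\in\mathcal{L}_X$; $\mathbf{SS}$ is the full subcategory of $\mathbf{LSS}$ of small spaces (identified, as below, with the small gtses and strictly continuous mappings). A family $\mathcal{U}$ of sets is essentially finite if some finite subfamily has the same union as $\mathcal{U}$;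 it is essentially finite on $S$ if $\{U\cap S:U\in\mathcal{U}\}$ is essentially finite. $EF(\mathcal{U},\mathcal{V})$ is the family of all subfamilies of $\mathcal{U}$ that are essentially finite on every member of $\mathcal{V}$, and $EssFin(\mathcal{U})=EF(\mathcal{U},\{X\})$ is the family of essentially finite subfamilies of $\mathcal{U}$. A (Delfs-Knebusch) generalized topological space (gts) is a triple $(X,Op_X,Cov_X)$ with $Op_X\subseteq\mathcal{P}(X)$, $Cov_X\subseteq\mathcal{P}(Op_X)$ such that: (finiteness) if $\mathcal{U}\subseteq Op_X$ is finite, then $\mathcal{U}\in Cov_X$ and $\bigcup\mathcal{U},\bigcap\mathcal{U}\in Op_X$ (with $\bigcap\emptyset=X$); (stability) if $V\in Op_X$ and $\mathcal{U}\in Cov_X$, then $\{V\cap U:U\in\mathcal{U}\}\in Cov_X$; (transitivity) if $\mathcal{U}\in Cov_X$ and, for each $U\in\mathcal{U}$, $\mathcal{V}(U)\in Cov_X$ with $\bigcup\mathcal{V}(U)=U$, then $\bigcup_{U\in\mathcal{U}}\mathcal{V}(U)\in Cov_X$; (saturation) if $\mathcal{U}\in Cov_X$, $\mathcal{V}\subseteq Op_X$, $\bigcup\mathcal{U}=\bigcup\mathcal{V}$ and each member of $\mathcal{U}$ is contained in a member of $\mathcal{V}$, then $\mathcal{V}\in Cov_X$; (regularity) if $\mathcal{U}\in Cov_X$, $W\subseteq\bigcup\mathcal{U}$ and $W\cap U\in Op_X$ for all $U\in\mathcal{U}$, then $W\in Op_X$. A mapping of gtses is strictly continuous if preimages of admissible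 families (members of $Cov$) are admissible; $\mathbf{GTS}$ is the category of gtses and strictly continuous mappings. A gts is small if every admissible family is essentially finite (on $X$). A small space $(X,\mathcal{L}_X)$ corresponds under the identification to the small gts $(X,\mathcal{L}_X,EssFin(\mathcal{L}_X))$. Concrete reflector means: for each object $(X,\mathcal{L}_X)$ of $\mathbf{LSS}$, the identity map $id_X:(X,\mathcal{L}_X)\to sm(X,\mathcal{L}_X)$ is a morphism of $\mathbf{LSS}$ and an $\mathbf{SS}$-reflection, i.e. every $\mathbf{LSS}$-morphism from $(X,\mathcal{L}_X)$ to an object of $\mathbf{SS}$ factors uniquely through it, and $sm$ is the resulting functor. *)

theory Defs
  imports "HOL-Library.FuncSet"
begin

text \<open>
  All categories below are constructs: an object \<open>A\<close> has an underlying set \<open>Und C A\<close>, and a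
  morphism is a mapping of underlying sets, represented as an element of \<open>Und C A \<rightarrow>\<^sub>E Und C B\<close>
  so that HOL equality of morphisms is equality of mappings. Identities and composition are
  therefore always the set-theoretic ones. As usual in HOL, the objects of a category range over
  the subsets of one arbitrary type \<open>'p\<close>, which plays the role of the universe.
\<close>

record ('o, 'p) construct =
  Ob :: "'o set"
  Und :: "'o \<Rightarrow> 'p set"
  Mor :: "'o \<Rightarrow> 'o \<Rightarrow> ('p \<Rightarrow> 'p) set"

definition id_map :: "'p set \<Rightarrow> 'p \<Rightarrow> 'p" where
  "id_map X = restrict id X"

definition is_category :: "('o, 'p) construct \<Rightarrow> bool" where
  "is_category C \<longleftrightarrow>
     (\<forall>A\<in>Ob C. \<forall>B\<in>Ob C. Mor C A B \<subseteq> Und C A \<rightarrow>\<^sub>E Und C B) \<and>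
     (\<forall>A\<in>Ob C. id_map (Und C A) \<in> Mor C A A) \<and>
     (\<forall>A\<in>Ob C. \<forall>B\<in>Ob C. \<forall>D\<in>Ob C. \<forall>f\<in>Mor C A B. \<forall>g\<in>Mor C B D.
        compose (Und C A) g f \<in> Mor C A D)"

definition subcategory :: "('o, 'p) construct \<Rightarrow> ('o, 'p) construct \<Rightarrow> bool" where
  "subcategory D C \<longleftrightarrow>
     is_category C \<and> is_category D \<and> Ob D \<subseteq> Ob C \<and>
     (\<forall>A\<in>Ob D. Und D A = Und C A) \<and>
     (\<forall>A\<in>Ob D. \<forall>B\<in>Ob D. Mor D A B \<subseteq> Mor C A B)"

definition full_subcat :: "('o, 'p) construct \<Rightarrow> ('o \<Rightarrow> bool) \<Rightarrow> ('o, 'p) construct" where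
  "full_subcat C P = \<lparr>Ob = {A \<in> Ob C. P A}, Und = Und C, Mor = Mor C\<rparr>"

record ('o, 'q, 'p) fctr =
  ob_map :: "'o \<Rightarrow> 'q"
  mor_map :: "'o \<Rightarrow> 'o \<Rightarrow> ('p \<Rightarrow> 'p) \<Rightarrow> ('p \<Rightarrow> 'p)"

definition is_functor ::
    "('o, 'p) construct \<Rightarrow> ('q, 'p) construct \<Rightarrow> ('o, 'q, 'p) fctr \<Rightarrow> bool" where
  "is_functor C D F \<longleftrightarrow>
     is_category C \<and> is_category D \<and>
     (\<forall>A\<in>Ob C. ob_map F A \<in> Ob D) \<and>
     (\<forall>A\<in>Ob C. \<forall>B\<in>Ob C. \<forall>f\<in>Mor C A B. mor_map F A B f \<in> Mor D (ob_map F A) (ob_map F B)) \<and>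
     (\<forall>A\<in>Ob C. mor_map F A A (id_map (Und C A)) = id_map (Und D (ob_map F A))) \<and>
     (\<forall>A\<in>Ob C. \<forall>B\<in>Ob C. \<forall>E\<in>Ob C. \<forall>f\<in>Mor C A B. \<forall>g\<in>Mor C B E.
        mor_map F A E (compose (Und C A) g f)
          = compose (Und D (ob_map F A)) (mor_map F B E g) (mor_map F A B f))"

definition full_embedding ::
    "('o, 'p) construct \<Rightarrow> ('q, 'p) construct \<Rightarrow> ('o, 'q, 'p) fctr \<Rightarrow> bool" where
  "full_embedding C D F \<longleftrightarrow>
     is_functor C D F \<and> inj_on (ob_map F) (Ob C) \<and>
     (\<forall>A\<in>Ob C. \<forall>B\<in>Ob C.
        bij_betw (mor_map F A B) (Mor C A B) (Mor D (ob_map F A) (ob_map F B)))"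

definition cat_isomorphism ::
    "('o, 'p) construct \<Rightarrow> ('q, 'p) construct \<Rightarrow> ('o, 'q, 'p) fctr \<Rightarrow> bool" where
  "cat_isomorphism C D F \<longleftrightarrow> full_embedding C D F \<and> ob_map F ` Ob C = Ob D"

definition fctr_comp ::
    "('q, 'r, 'p) fctr \<Rightarrow> ('o, 'q, 'p) fctr \<Rightarrow> ('o, 'r, 'p) fctr" where
  "fctr_comp G F =
     \<lparr>ob_map = (\<lambda>A. ob_map G (ob_map F A)),
      mor_map = (\<lambda>A B f. mor_map G (ob_map F A) (ob_map F B) (mor_map F A B f))\<rparr>"

definition functors_eq_on ::
    "('o, 'p) construct \<Rightarrow> ('o, 'q, 'p) fctr \<Rightarrow> ('o, 'q, 'p) fctr \<Rightarrow> bool" where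
  "functors_eq_on C F G \<longleftrightarrow>
     (\<forall>A\<in>Ob C. ob_map F A = ob_map G A) \<and>
     (\<forall>A\<in>Ob C. \<forall>B\<in>Ob C. \<forall>f\<in>Mor C A B. mor_map F A B f = mor_map G A B f)"

definition is_reflection ::
    "('o, 'p) construct \<Rightarrow> ('o, 'p) construct \<Rightarrow> 'o \<Rightarrow> 'o \<Rightarrow> ('p \<Rightarrow> 'p) \<Rightarrow> bool" where
  "is_reflection C D A R r \<longleftrightarrow>
     R \<in> Ob D \<and> r \<in> Mor C A R \<and>
     (\<forall>B\<in>Ob D. \<forall>f\<in>Mor C A B. \<exists>!g. g \<in> Mor D R B \<and> compose (Und C A) g r = f)"

text \<open>
  The last conjunct says that \<open>F\<close> is the functor resulting from the reflection arrows: \<open>F f\<close> is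
  the (by the universal property unique) morphism making the reflection square of \<open>f\<close> commute.
\<close>

definition concrete_reflector ::
    "('o, 'p) construct \<Rightarrow> ('o, 'p) construct \<Rightarrow> ('o, 'o, 'p) fctr \<Rightarrow> bool" where
  "concrete_reflector C D F \<longleftrightarrow>
     subcategory D C \<and> is_functor C D F \<and>
     (\<forall>A\<in>Ob C. Und D (ob_map F A) = Und C A \<and>
        is_reflection C D A (ob_map F A) (id_map (Und C A))) \<and>
     (\<forall>A\<in>Ob C. \<forall>B\<in>Ob C. \<forall>f\<in>Mor C A B.
        compose (Und C A) (mor_map F A B f) (id_map (Und C A))
          = compose (Und C A) (id_map (Und C B)) f)"


type_synonym 'a lss = "'a set \<times> 'a set set"

definition locally_small_space :: "'a set \<Rightarrow> 'a set set \<Rightarrow> bool" where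
  "locally_small_space X \<L> \<longleftrightarrow>
     \<L> \<subseteq> Pow X \<and> {} \<in> \<L> \<and> (\<forall>L\<in>\<L>. \<forall>M\<in>\<L>. L \<inter> M \<in> \<L> \<and> L \<union> M \<in> \<L>) \<and> \<Union>\<L> = X"

text \<open>\<open>compat X \<A>\<close> is the family written \<open>\<A>\<^sup>o\<close> (relative to the set \<open>X\<close>).\<close>

definition compat :: "'a set \<Rightarrow> 'a set set \<Rightarrow> 'a set set" where
  "compat X \<A> = {V. V \<subseteq> X \<and> (\<forall>A\<in>\<A>. V \<inter> A \<in> \<A>)}"

definition bounded_map :: "'a lss \<Rightarrow> 'b lss \<Rightarrow> ('a \<Rightarrow> 'b) \<Rightarrow> bool" where
  "bounded_map A B f \<longleftrightarrow> (\<forall>L\<in>snd A. \<exists>M\<in>snd B. L \<subseteq> f -` M \<inter> fst A)"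

definition continuous_lss :: "'a lss \<Rightarrow> 'b lss \<Rightarrow> ('a \<Rightarrow> 'b) \<Rightarrow> bool" where
  "continuous_lss A B f \<longleftrightarrow> (\<forall>M\<in>snd B. f -` M \<inter> fst A \<in> compat (fst A) (snd A))"

definition lss_mor :: "'a lss \<Rightarrow> 'b lss \<Rightarrow> ('a \<Rightarrow> 'b) set" where
  "lss_mor A B = {f \<in> fst A \<rightarrow>\<^sub>E fst B. bounded_map A B f \<and> continuous_lss A B f}"

definition small_lss :: "'a lss \<Rightarrow> bool" where
  "small_lss A \<longleftrightarrow> fst A \<in> snd A"

definition LSS :: "('a lss, 'a) construct" where
  "LSS = \<lparr>Ob = {(X, \<L>). locally_small_space X \<L>}, Und = fst, Mor = lss_mor\<rparr>"

definition SS :: "('a lss, 'a) construct" where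
  "SS = full_subcat LSS small_lss"

definition sm_LSS :: "('a lss, 'a lss, 'a) fctr" where
  "sm_LSS = \<lparr>ob_map = (\<lambda>(X, \<L>). (X, compat X \<L>)), mor_map = (\<lambda>A B f. f)\<rparr>"


definition essentially_finite :: "'a set set \<Rightarrow> bool" where
  "essentially_finite \<U> \<longleftrightarrow> (\<exists>\<F>. finite \<F> \<and> \<F> \<subseteq> \<U> \<and> \<Union>\<F> = \<Union>\<U>)"

definition essentially_finite_on :: "'a set set \<Rightarrow> 'a set \<Rightarrow> bool" where
  "essentially_finite_on \<U> S \<longleftrightarrow> essentially_finite ((\<lambda>U. U \<inter> S) ` \<U>)"

definition EF :: "'a set set \<Rightarrow> 'a set set \<Rightarrow> 'a set set set" where
  "EF \<U> \<V> = {\<W>. \<W> \<subseteq> \<U> \<and> (\<forall>S\<in>\<V>. essentially_finite_on \<W> S)}"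

definition EssFin :: "'a set \<Rightarrow> 'a set set \<Rightarrow> 'a set set set" where
  "EssFin X \<U> = EF \<U> {X}"

type_synonym 'a gts = "'a set \<times> 'a set set \<times> 'a set set set"

text \<open>
  In the first axiom, \<open>X \<inter> \<Inter>\<U>\<close> is \<open>\<Inter>\<U>\<close> for nonempty \<open>\<U>\<close>, and it is \<open>X\<close> for \<open>\<U> = {}\<close>
  (whereas \<open>\<Inter>{}\<close> is the whole type in HOL).
\<close>

definition gen_top_space :: "'a set \<Rightarrow> 'a set set \<Rightarrow> 'a set set set \<Rightarrow> bool" where
  "gen_top_space X Op Cov \<longleftrightarrow>
     Op \<subseteq> Pow X \<and> Cov \<subseteq> Pow Op \<and>
     (\<forall>\<U>. \<U> \<subseteq> Op \<and> finite \<U> \<longrightarrow> \<U> \<in> Cov \<and> \<Union>\<U> \<in> Op \<and> X \<inter> \<Inter>\<U> \<in> Op) \<and>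
     (\<forall>V\<in>Op. \<forall>\<U>\<in>Cov. (\<lambda>U. V \<inter> U) ` \<U> \<in> Cov) \<and>
     (\<forall>\<U>\<in>Cov. \<forall>\<V>. (\<forall>U\<in>\<U>. \<V> U \<in> Cov \<and> \<Union>(\<V> U) = U) \<longrightarrow> (\<Union>U\<in>\<U>. \<V> U) \<in> Cov) \<and>
     (\<forall>\<U>\<in>Cov. \<forall>\<V>. \<V> \<subseteq> Op \<and> \<Union>\<U> = \<Union>\<V> \<and> (\<forall>U\<in>\<U>. \<exists>V\<in>\<V>. U \<subseteq> V) \<longrightarrow> \<V> \<in> Cov) \<and>
     (\<forall>\<U>\<in>Cov. \<forall>W. W \<subseteq> \<Union>\<U> \<and> (\<forall>U\<in>\<U>. W \<inter> U \<in> Op) \<longrightarrow> W \<in> Op)"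

definition strictly_continuous :: "'a gts \<Rightarrow> 'b gts \<Rightarrow> ('a \<Rightarrow> 'b) \<Rightarrow> bool" where
  "strictly_continuous A B f \<longleftrightarrow>
     (\<forall>\<V>\<in>snd (snd B). (\<lambda>V. f -` V \<inter> fst A) ` \<V> \<in> snd (snd A))"

definition gts_mor :: "'a gts \<Rightarrow> 'b gts \<Rightarrow> ('a \<Rightarrow> 'b) set" where
  "gts_mor A B = {f \<in> fst A \<rightarrow>\<^sub>E fst B. strictly_continuous A B f}"

definition small_gts :: "'a gts \<Rightarrow> bool" where
  "small_gts A \<longleftrightarrow> (\<forall>\<U>\<in>snd (snd A). essentially_finite_on \<U> (fst A))"

definition GTS :: "('a gts, 'a) construct" where
  "GTS = \<lparr>Ob = {(X, Op, Cov). gen_top_space X Op Cov}, Und = fst, Mor = gts_mor\<rparr>"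

definition SS_GTS :: "('a gts, 'a) construct" where
  "SS_GTS = full_subcat GTS small_gts"

definition sm_GTS :: "('a gts, 'a gts, 'a) fctr" where
  "sm_GTS = \<lparr>ob_map = (\<lambda>(X, Op, Cov). (X, Op, EssFin X Op)), mor_map = (\<lambda>A B f. f)\<rparr>"

definition ident_LSS :: "('a lss, 'a gts, 'a) fctr" where
  "ident_LSS = \<lparr>ob_map = (\<lambda>(X, \<L>). (X, compat X \<L>, EF (compat X \<L>) \<L>)),
                mor_map = (\<lambda>A B f. f)\<rparr>"

definition ident_SS :: "('a lss, 'a gts, 'a) fctr" where
  "ident_SS = \<lparr>ob_map = (\<lambda>(X, \<L>). (X, \<L>, EssFin X \<L>)), mor_map = (\<lambda>A B f. f)\<rparr>"

end

theory Submission
  imports Defs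
begin

text \<open>
  Write \<open>\<L>\<^sup>o\<close> for \<open>compat X \<L>\<close>, and call the members of \<open>\<L>\<close> smops (small open sets). Three
  observations carry the proof.

  A family \<open>\<W>\<close> is essentially finite on \<open>S\<close> iff finitely many members of \<open>\<W>\<close> cover
  \<open>\<Union>\<W> \<inter> S\<close> (\<open>essentially_finite_on_iff\<close>), so essential finiteness is a compactness
  condition. Read in this way, it makes the axioms of a generalized topology for
  \<open>(X, \<L>\<^sup>o, EF(\<L>\<^sup>o, \<L>))\<close> reduce to the closure of \<open>\<L>\<close> under finite unions
  (\<open>gen_top_space_EF\<close>).

  The family \<open>\<L>\<close> itself is admissible in this generalized topology, because each \<open>L \<in> \<L>\<close> is
  covered by the single member \<open>L\<close> (\<open>smops_admissible\<close>). Testing a strictly continuous map on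
  this one family recovers both continuity and boundedness, whence fullness
  (\<open>lss_mor_eq_gts_mor\<close>). Applied to two families \<open>\<L>\<close> and \<open>\<L>'\<close> with the same associated
  generalized topology, it shows that each member of one lies in a member of the other, and then
  \<open>\<L>\<^sup>o = \<L>'\<^sup>o\<close> forces \<open>\<L> = \<L>'\<close> (\<open>EF_determines_smops\<close>), whence injectivity on objects.

  Finally, bounded continuous maps pull \<open>\<M>\<^sup>o\<close> back into \<open>\<L>\<^sup>o\<close>, not only \<open>\<M>\<close>
  (\<open>vimage_compat\<close>), and \<open>\<L>\<^sup>o = \<L>\<close> as soon as \<open>X \<in> \<L>\<close> (\<open>compat_small\<close>). Hence \<open>(X, \<L>\<^sup>o)\<close>
  is a small space, and a bounded continuous map into a small space remains one when \<open>\<L>\<close> is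
  replaced by \<open>\<L>\<^sup>o\<close>; the reflection property is thus witnessed by the map itself. For a small
  space \<open>EF(\<L>\<^sup>o, \<L>)\<close> is \<open>EssFin(\<L>)\<close>, and saturation shows that in a small generalized
  topological space the admissible families are exactly the essentially finite ones
  (\<open>small_gts_Cov\<close>); this gives the isomorphism between the two notions of small space.
\<close>

section \<open>Essential finiteness\<close>

lemma essentially_finite_on_iff:
  "essentially_finite_on \<W> S \<longleftrightarrow> (\<exists>\<F>. finite \<F> \<and> \<F> \<subseteq> \<W> \<and> \<Union>\<W> \<inter> S \<subseteq> \<Union>\<F>)"
proof
  assume "essentially_finite_on \<W> S"
  then obtain \<G> where "finite \<G>" "\<G> \<subseteq> (\<lambda>U. U \<inter> S) ` \<W>" and
    un: "\<Union>\<G> = \<Union>((\<lambda>U. U \<inter> S) ` \<W>)"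
    by (auto simp: essentially_finite_on_def essentially_finite_def)
  then obtain \<F> where "finite \<F>" "\<F> \<subseteq> \<W>" "\<G> = (\<lambda>U. U \<inter> S) ` \<F>"
    by (meson finite_subset_image)
  moreover from this un have "\<Union>\<W> \<inter> S \<subseteq> \<Union>\<F>"
    by blast
  ultimately show "\<exists>\<F>. finite \<F> \<and> \<F> \<subseteq> \<W> \<and> \<Union>\<W> \<inter> S \<subseteq> \<Union>\<F>"
    by blast
next
  assume "\<exists>\<F>. finite \<F> \<and> \<F> \<subseteq> \<W> \<and> \<Union>\<W> \<inter> S \<subseteq> \<Union>\<F>"
  then obtain \<F> where "finite \<F>" "\<F> \<subseteq> \<W>" "\<Union>\<W> \<inter> S \<subseteq> \<Union>\<F>"
    by blast
  then show "essentially_finite_on \<W> S"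
    unfolding essentially_finite_on_def essentially_finite_def
    by (intro exI[of _ "(\<lambda>U. U \<inter> S) ` \<F>"]) blast
qed

lemma essentially_finite_onI:
  assumes "finite \<F>" "\<F> \<subseteq> \<W>" "\<Union>\<W> \<inter> S \<subseteq> \<Union>\<F>"
  shows "essentially_finite_on \<W> S"
  using assms by (auto simp: essentially_finite_on_iff)

lemma essentially_finite_onE:
  assumes "essentially_finite_on \<W> S"
  obtains \<F> where "finite \<F>" "\<F> \<subseteq> \<W>" "\<Union>\<W> \<inter> S \<subseteq> \<Union>\<F>"
  using assms by (auto simp: essentially_finite_on_iff)

lemma essentially_finite_on_mono:
  assumes "essentially_finite_on \<W> S" "T \<subseteq> S"
  shows "essentially_finite_on \<W> T"
  using assms unfolding essentially_finite_on_iff by (meson Int_mono order_refl order_trans)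

lemma essentially_finite_on_vimage:
  assumes "essentially_finite_on \<W> T" "S \<subseteq> X" "S \<subseteq> f -` T"
  shows "essentially_finite_on ((\<lambda>V. f -` V \<inter> X) ` \<W>) S"
  using assms(1)
proof (rule essentially_finite_onE)
  fix \<F> assume \<F>: "finite \<F>" "\<F> \<subseteq> \<W>" "\<Union>\<W> \<inter> T \<subseteq> \<Union>\<F>"
  show ?thesis
  proof (rule essentially_finite_onI)
    show "finite ((\<lambda>V. f -` V \<inter> X) ` \<F>)" "(\<lambda>V. f -` V \<inter> X) ` \<F> \<subseteq> (\<lambda>V. f -` V \<inter> X) ` \<W>"
      using \<F>(1,2) by (auto intro: image_mono)
    show "\<Union>((\<lambda>V. f -` V \<inter> X) ` \<W>) \<inter> S \<subseteq> \<Union>((\<lambda>V. f -` V \<inter> X) ` \<F>)"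
    proof
      fix x assume "x \<in> \<Union>((\<lambda>V. f -` V \<inter> X) ` \<W>) \<inter> S"
      then have "x \<in> X" "f x \<in> \<Union>\<W> \<inter> T"
        using assms(2,3) by auto
      with \<F>(3) show "x \<in> \<Union>((\<lambda>V. f -` V \<inter> X) ` \<F>)"
        by auto
    qed
  qed
qed

lemma EF_iff: "\<W> \<in> EF \<U> \<V> \<longleftrightarrow> \<W> \<subseteq> \<U> \<and> (\<forall>S\<in>\<V>. essentially_finite_on \<W> S)"
  by (simp add: EF_def)

section \<open>Locally small spaces and the family \<open>\<L>\<^sup>o\<close>\<close>

lemma locally_small_finite_Union:
  assumes "locally_small_space X \<L>" "finite \<F>" "\<F> \<subseteq> \<L>"
  shows "\<Union>\<F> \<in> \<L>"
  using assms(2,3,1) by (induction rule: finite_induct) (auto simp: locally_small_space_def)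

lemma compat_iff: "V \<in> compat X \<L> \<longleftrightarrow> V \<subseteq> X \<and> (\<forall>A\<in>\<L>. V \<inter> A \<in> \<L>)"
  by (simp add: compat_def)

lemma smops_subset_compat: "locally_small_space X \<L> \<Longrightarrow> \<L> \<subseteq> compat X \<L>"
  by (auto simp: locally_small_space_def compat_iff)

lemma compat_space: "locally_small_space X \<L> \<Longrightarrow> X \<in> compat X \<L>"
  by (auto simp: locally_small_space_def compat_iff Int_absorb1)

text \<open>
  The hypothesis exhibits the trace of \<open>W\<close> on a smop as a finite union of smops. This is the
  common core of the closure of \<open>\<L>\<^sup>o\<close> under finite unions and of the regularity axiom.
\<close>

lemma compat_local:
  assumes ls: "locally_small_space X \<L>" and W: "W \<subseteq> X"
    and fin: "\<And>A. A \<in> \<L> \<Longrightarrow>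
      \<exists>\<F>. finite \<F> \<and> (\<forall>U\<in>\<F>. W \<inter> U \<in> compat X \<L>) \<and> W \<inter> A \<subseteq> \<Union>\<F>"
  shows "W \<in> compat X \<L>"
  unfolding compat_iff
proof (intro conjI W ballI)
  fix A assume A: "A \<in> \<L>"
  with fin obtain \<F> where \<F>: "finite \<F>" "\<forall>U\<in>\<F>. W \<inter> U \<in> compat X \<L>" "W \<inter> A \<subseteq> \<Union>\<F>"
    by meson
  have "\<Union>((\<lambda>U. (W \<inter> U) \<inter> A) ` \<F>) \<in> \<L>"
    by (rule locally_small_finite_Union[OF ls]) (use \<F> A in \<open>auto simp: compat_iff\<close>)
  moreover have "\<Union>((\<lambda>U. (W \<inter> U) \<inter> A) ` \<F>) = W \<inter> A"
    using \<F>(3) by blast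
  ultimately show "W \<inter> A \<in> \<L>"
    by simp
qed

lemma compat_finite_Union:
  assumes "locally_small_space X \<L>" "finite \<F>" "\<F> \<subseteq> compat X \<L>"
  shows "\<Union>\<F> \<in> compat X \<L>"
proof (rule compat_local[OF assms(1)])
  show "\<Union>\<F> \<subseteq> X"
    using assms(3) by (auto simp: compat_def)
  have "\<Union>\<F> \<inter> U = U" if "U \<in> \<F>" for U
    using that by blast
  then show "\<exists>\<G>. finite \<G> \<and> (\<forall>U\<in>\<G>. \<Union>\<F> \<inter> U \<in> compat X \<L>) \<and> \<Union>\<F> \<inter> A \<subseteq> \<Union>\<G>" for A
    using assms(2,3) by (intro exI[of _ \<F>]) auto
qed

lemma compat_Int: "V \<in> compat X \<L> \<Longrightarrow> W \<in> compat X \<L> \<Longrightarrow> V \<inter> W \<in> compat X \<L>"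
  by (auto simp: compat_iff Int_assoc)

lemma compat_finite_Inter:
  assumes "locally_small_space X \<L>" "finite \<F>" "\<F> \<subseteq> compat X \<L>"
  shows "X \<inter> \<Inter>\<F> \<in> compat X \<L>"
  using assms(2,3)
proof (induction rule: finite_induct)
  case empty
  then show ?case by (simp add: compat_space[OF assms(1)])
next
  case (insert V \<F>)
  then have "V \<inter> (X \<inter> \<Inter>\<F>) \<in> compat X \<L>"
    by (intro compat_Int[of V _ _ "X \<inter> \<Inter>\<F>"]) simp_all
  then show ?case by (simp add: Int_left_commute)
qed

lemma locally_small_compat:
  assumes "locally_small_space X \<L>"
  shows "locally_small_space X (compat X \<L>)"
proof -
  have "V \<union> W \<in> compat X \<L>" if "V \<in> compat X \<L>" "W \<in> compat X \<L>" for V W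
    using compat_finite_Union[OF assms, of "{V, W}"] that by simp
  moreover have "{} \<in> compat X \<L>"
    using compat_finite_Union[OF assms, of "{}"] by simp
  moreover have "compat X \<L> \<subseteq> Pow X"
    by (auto simp: compat_iff)
  ultimately show ?thesis
    using compat_space[OF assms] by (auto simp: locally_small_space_def compat_Int)
qed

lemma compat_small:
  assumes "locally_small_space X \<L>" "X \<in> \<L>"
  shows "compat X \<L> = \<L>"
proof
  show "compat X \<L> \<subseteq> \<L>"
    using assms(2) by (force simp: compat_iff Int_absorb2)
qed (rule smops_subset_compat[OF assms(1)])

text \<open>
  A member of \<open>\<M>\<^sup>o\<close> may be cut down to a member of \<open>\<M>\<close> without changing its preimage
  inside a given \<open>L \<in> \<L>\<close>, because boundedness places \<open>L\<close> over some \<open>M \<in> \<M>\<close>.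
\<close>

lemma vimage_compat:
  assumes lX: "locally_small_space X \<L>" and bd: "bounded_map (X, \<L>) (Y, \<M>) f"
    and cont: "continuous_lss (X, \<L>) (Y, \<M>) f" and V: "V \<in> compat Y \<M>"
  shows "f -` V \<inter> X \<in> compat X \<L>"
  unfolding compat_iff
proof (intro conjI ballI)
  fix L assume L: "L \<in> \<L>"
  with bd obtain M where M: "M \<in> \<M>" "L \<subseteq> f -` M \<inter> X"
    by (auto simp: bounded_map_def)
  have "f -` (V \<inter> M) \<inter> X \<in> compat X \<L>"
    using cont V M(1) by (simp add: continuous_lss_def compat_iff[of V] del: vimage_Int)
  then have "f -` (V \<inter> M) \<inter> X \<inter> L \<in> \<L>"
    using L by (auto simp: compat_iff)
  moreover have "f -` (V \<inter> M) \<inter> X \<inter> L = f -` V \<inter> X \<inter> L"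
    using M(2) by blast
  ultimately show "f -` V \<inter> X \<inter> L \<in> \<L>"
    by simp
qed simp

lemma bounded_map_small:
  assumes "locally_small_space X \<L>" "f \<in> X \<rightarrow> Y" "Y \<in> \<M>"
  shows "bounded_map (X, \<L>) (Y, \<M>) f"
proof -
  have "L \<subseteq> f -` Y \<inter> X" if "L \<in> \<L>" for L
    using assms(1,2) that by (auto simp: locally_small_space_def)
  then show ?thesis
    using assms(3) by (auto simp: bounded_map_def)
qed

text \<open>
  This is the existence half of the universal property of \<open>(X, \<L>\<^sup>o)\<close>. It is stated with
  \<open>\<M>\<^sup>o\<close> in the target, where it also gives the functoriality of smallification; for a small
  target \<open>\<M>\<^sup>o = \<M>\<close>.
\<close>

lemma lss_mor_compat:
  assumes lX: "locally_small_space X \<L>" and lY: "locally_small_space Y \<M>"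
    and f: "f \<in> lss_mor (X, \<L>) (Y, \<M>)"
  shows "f \<in> lss_mor (X, compat X \<L>) (Y, compat Y \<M>)"
proof -
  have fE: "f \<in> X \<rightarrow>\<^sub>E Y" and bd: "bounded_map (X, \<L>) (Y, \<M>) f"
    and cont: "continuous_lss (X, \<L>) (Y, \<M>) f"
    using f by (auto simp: lss_mor_def)
  have "bounded_map (X, compat X \<L>) (Y, compat Y \<M>) f"
    using fE by (intro bounded_map_small locally_small_compat lX compat_space[OF lY]) auto
  moreover have "continuous_lss (X, compat X \<L>) (Y, compat Y \<M>) f"
    using vimage_compat[OF lX bd cont] smops_subset_compat[OF locally_small_compat[OF lX]]
    by (auto simp: continuous_lss_def)
  ultimately show ?thesis
    using fE by (simp add: lss_mor_def)
qed

lemma id_map_mor_compat: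
  assumes "locally_small_space X \<L>"
  shows "id_map X \<in> lss_mor (X, \<L>) (X, compat X \<L>)"
proof -
  have "id_map X -` V \<inter> X = V" if "V \<in> compat X \<L>" for V
    using that by (auto simp: compat_iff id_map_def)
  moreover have "id_map X \<in> X \<rightarrow>\<^sub>E X"
    by (auto simp: id_map_def)
  moreover have "bounded_map (X, \<L>) (X, compat X \<L>) (id_map X)"
    by (rule bounded_map_small[OF assms _ compat_space[OF assms]]) (auto simp: id_map_def)
  ultimately show ?thesis
    by (auto simp: lss_mor_def continuous_lss_def)
qed

lemma compose_id_map: "g \<in> extensional X \<Longrightarrow> compose X g (id_map X) = g"
  by (auto simp: compose_def id_map_def fun_eq_iff extensional_def)

lemma compose_id_map_left: "f \<in> X \<rightarrow>\<^sub>E Y \<Longrightarrow> compose X (id_map Y) f = f"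
  by (auto simp: compose_def id_map_def fun_eq_iff PiE_def extensional_def)

text \<open>
  The reflection arrow is the identity on \<open>X\<close>, so \<open>f\<close> itself is the only candidate for the
  factorization.
\<close>

lemma smallification_universal:
  assumes lX: "locally_small_space X \<L>" and lY: "locally_small_space Y \<M>" and Y: "Y \<in> \<M>"
    and f: "f \<in> lss_mor (X, \<L>) (Y, \<M>)"
  shows "\<exists>!g. g \<in> lss_mor (X, compat X \<L>) (Y, \<M>) \<and> compose X g (id_map X) = f"
proof (rule ex1I[of _ f])
  have "f \<in> extensional X"
    using f by (auto simp: lss_mor_def PiE_def)
  then show "f \<in> lss_mor (X, compat X \<L>) (Y, \<M>) \<and> compose X f (id_map X) = f"
    using lss_mor_compat[OF lX lY f] compat_small[OF lY Y] by (simp add: compose_id_map)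
next
  fix g assume g: "g \<in> lss_mor (X, compat X \<L>) (Y, \<M>) \<and> compose X g (id_map X) = f"
  then have "g \<in> extensional X"
    by (auto simp: lss_mor_def PiE_def)
  with g show "g = f"
    by (simp add: compose_id_map)
qed

section \<open>The generalized topology of a locally small space\<close>

lemma EF_small:
  assumes "locally_small_space X \<L>" "X \<in> \<L>"
  shows "EF (compat X \<L>) \<L> = EssFin X \<L>"
proof -
  have "L \<subseteq> X" if "L \<in> \<L>" for L
    using assms(1) that by (auto simp: locally_small_space_def)
  then have "(\<forall>S\<in>\<L>. essentially_finite_on \<W> S) \<longleftrightarrow> essentially_finite_on \<W> X" for \<W>
    using assms(2) essentially_finite_on_mono[of \<W> X] by meson
  then show ?thesis
    by (simp add: compat_small[OF assms] EssFin_def EF_def)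
qed

lemma gen_top_space_EF:
  assumes ls: "locally_small_space X \<L>"
  shows "gen_top_space X (compat X \<L>) (EF (compat X \<L>) \<L>)"
proof -
  let ?Op = "compat X \<L>" and ?Cov = "EF (compat X \<L>) \<L>"
  have finiteness: "\<U> \<in> ?Cov \<and> \<Union>\<U> \<in> ?Op \<and> X \<inter> \<Inter>\<U> \<in> ?Op"
    if "\<U> \<subseteq> ?Op" "finite \<U>" for \<U>
    using that by (auto simp: EF_iff compat_finite_Union[OF ls] compat_finite_Inter[OF ls]
        intro: essentially_finite_onI[of \<U>])
  have stability: "(\<lambda>U. V \<inter> U) ` \<U> \<in> ?Cov" if V: "V \<in> ?Op" and \<U>: "\<U> \<in> ?Cov" for V \<U>
    unfolding EF_iff
  proof (intro conjI ballI)
    show "(\<lambda>U. V \<inter> U) ` \<U> \<subseteq> ?Op"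
      using V \<U> by (auto simp: EF_iff compat_Int)
    fix S assume "S \<in> \<L>"
    then have "essentially_finite_on \<U> S"
      using \<U> by (simp add: EF_iff)
    then obtain \<F> where "finite \<F>" "\<F> \<subseteq> \<U>" "\<Union>\<U> \<inter> S \<subseteq> \<Union>\<F>"
      by (rule essentially_finite_onE)
    then show "essentially_finite_on ((\<lambda>U. V \<inter> U) ` \<U>) S"
      by (intro essentially_finite_onI[of "(\<lambda>U. V \<inter> U) ` \<F>"]) blast+
  qed
  have transitivity: "(\<Union>U\<in>\<U>. \<V> U) \<in> ?Cov"
    if \<U>: "\<U> \<in> ?Cov" and \<V>: "\<forall>U\<in>\<U>. \<V> U \<in> ?Cov \<and> \<Union>(\<V> U) = U" for \<U> \<V>
    unfolding EF_iff
  proof (intro conjI ballI)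
    show "(\<Union>U\<in>\<U>. \<V> U) \<subseteq> ?Op"
      using \<V> by (auto simp: EF_iff)
    fix S assume S: "S \<in> \<L>"
    then have "essentially_finite_on \<U> S"
      using \<U> by (simp add: EF_iff)
    then obtain \<F> where \<F>: "finite \<F>" "\<F> \<subseteq> \<U>" "\<Union>\<U> \<inter> S \<subseteq> \<Union>\<F>"
      by (rule essentially_finite_onE)
    have "\<forall>U\<in>\<U>. \<exists>\<G>. finite \<G> \<and> \<G> \<subseteq> \<V> U \<and> U \<inter> S \<subseteq> \<Union>\<G>"
      using \<V> S by (metis EF_iff essentially_finite_on_iff)
    then obtain \<G> where \<G>: "\<And>U. U \<in> \<U> \<Longrightarrow> finite (\<G> U) \<and> \<G> U \<subseteq> \<V> U \<and> U \<inter> S \<subseteq> \<Union>(\<G> U)"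
      by metis
    show "essentially_finite_on (\<Union>U\<in>\<U>. \<V> U) S"
    proof (rule essentially_finite_onI)
      show "finite (\<Union>U\<in>\<F>. \<G> U)" "(\<Union>U\<in>\<F>. \<G> U) \<subseteq> (\<Union>U\<in>\<U>. \<V> U)"
        using \<F> \<G> by blast+
      show "\<Union>(\<Union>U\<in>\<U>. \<V> U) \<inter> S \<subseteq> \<Union>(\<Union>U\<in>\<F>. \<G> U)"
      proof
        fix x assume x: "x \<in> \<Union>(\<Union>U\<in>\<U>. \<V> U) \<inter> S"
        then have "x \<in> \<Union>\<U>"
          using \<V> by blast
        with x \<F>(3) obtain U where "U \<in> \<F>" "x \<in> U"
          by blast
        then show "x \<in> \<Union>(\<Union>U\<in>\<F>. \<G> U)"
          using x \<F>(2) \<G>[of U] by blast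
      qed
    qed
  qed
  have saturation: "\<V> \<in> ?Cov"
    if \<U>: "\<U> \<in> ?Cov" and \<V>: "\<V> \<subseteq> ?Op" "\<Union>\<U> = \<Union>\<V>" "\<forall>U\<in>\<U>. \<exists>V\<in>\<V>. U \<subseteq> V" for \<U> \<V>
    unfolding EF_iff
  proof (intro conjI ballI \<V>(1))
    fix S assume "S \<in> \<L>"
    then have "essentially_finite_on \<U> S"
      using \<U> by (simp add: EF_iff)
    then obtain \<F> where \<F>: "finite \<F>" "\<F> \<subseteq> \<U>" "\<Union>\<U> \<inter> S \<subseteq> \<Union>\<F>"
      by (rule essentially_finite_onE)
    obtain v where v: "\<And>U. U \<in> \<U> \<Longrightarrow> v U \<in> \<V> \<and> U \<subseteq> v U"
      using \<V>(3) by metis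
    show "essentially_finite_on \<V> S"
    proof (rule essentially_finite_onI)
      show "finite (v ` \<F>)" "v ` \<F> \<subseteq> \<V>"
        using \<F> v by auto
      have "U \<subseteq> \<Union>(v ` \<F>)" if "U \<in> \<F>" for U
        using v[of U] \<F>(2) that by blast
      then have "\<Union>\<F> \<subseteq> \<Union>(v ` \<F>)"
        by (rule Union_least)
      then show "\<Union>\<V> \<inter> S \<subseteq> \<Union>(v ` \<F>)"
        using \<F>(3) \<V>(2) by simp
    qed
  qed
  have regularity: "W \<in> ?Op"
    if \<U>: "\<U> \<in> ?Cov" and W: "W \<subseteq> \<Union>\<U>" "\<forall>U\<in>\<U>. W \<inter> U \<in> ?Op" for \<U> W
  proof (rule compat_local[OF ls])
    show "W \<subseteq> X"
      using \<U> W(1) by (fastforce simp: EF_iff compat_iff)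
    fix A assume "A \<in> \<L>"
    then have "essentially_finite_on \<U> A"
      using \<U> by (simp add: EF_iff)
    then obtain \<F> where \<F>: "finite \<F>" "\<F> \<subseteq> \<U>" "\<Union>\<U> \<inter> A \<subseteq> \<Union>\<F>"
      by (rule essentially_finite_onE)
    then show "\<exists>\<F>. finite \<F> \<and> (\<forall>U\<in>\<F>. W \<inter> U \<in> ?Op) \<and> W \<inter> A \<subseteq> \<Union>\<F>"
      using W by (intro exI[of _ \<F>]) blast
  qed
  have families: "?Op \<subseteq> Pow X" "?Cov \<subseteq> Pow ?Op"
    by (auto simp: compat_def EF_def)
  show ?thesis
    unfolding gen_top_space_def
  proof (intro conjI ballI allI impI families)
    fix \<U> assume "\<U> \<subseteq> ?Op \<and> finite \<U>"
    then show "\<U> \<in> ?Cov" "\<Union>\<U> \<in> ?Op" "X \<inter> \<Inter>\<U> \<in> ?Op"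
      using finiteness by simp_all
  next
    fix V \<U> assume "V \<in> ?Op" "\<U> \<in> ?Cov"
    then show "(\<lambda>U. V \<inter> U) ` \<U> \<in> ?Cov"
      by (rule stability)
  next
    fix \<U> \<V> assume "\<U> \<in> ?Cov" "\<forall>U\<in>\<U>. \<V> U \<in> ?Cov \<and> \<Union>(\<V> U) = U"
    then show "(\<Union>U\<in>\<U>. \<V> U) \<in> ?Cov"
      by (rule transitivity)
  next
    fix \<U> \<V> assume "\<U> \<in> ?Cov"
      "\<V> \<subseteq> ?Op \<and> \<Union>\<U> = \<Union>\<V> \<and> (\<forall>U\<in>\<U>. \<exists>V\<in>\<V>. U \<subseteq> V)"
    then show "\<V> \<in> ?Cov"
      using saturation[of \<U> \<V>] by simp
  next
    fix \<U> W assume "\<U> \<in> ?Cov" "W \<subseteq> \<Union>\<U> \<and> (\<forall>U\<in>\<U>. W \<inter> U \<in> ?Op)"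
    then show "W \<in> ?Op"
      using regularity[of \<U> W] by simp
  qed
qed

lemma smops_admissible:
  assumes "locally_small_space X \<L>"
  shows "\<L> \<in> EF (compat X \<L>) \<L>"
  unfolding EF_iff
proof (intro conjI ballI)
  show "essentially_finite_on \<L> S" if "S \<in> \<L>" for S
    by (rule essentially_finite_onI[of "{S}"]) (use that in auto)
qed (rule smops_subset_compat[OF assms])

text \<open>
  In the harder inclusion, strict continuity is applied to the admissible family \<open>\<M>\<close>
  only: that the preimages belong to \<open>\<L>\<^sup>o\<close> is continuity, and that they are essentially finite
  on \<open>L\<close> means that \<open>L\<close> lies over a finite union of members of \<open>\<M>\<close>, which is boundedness.
\<close>

lemma lss_mor_eq_gts_mor:
  assumes lX: "locally_small_space X \<L>" and lY: "locally_small_space Y \<M>"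
  shows "lss_mor (X, \<L>) (Y, \<M>) =
    gts_mor (X, compat X \<L>, EF (compat X \<L>) \<L>) (Y, compat Y \<M>, EF (compat Y \<M>) \<M>)"
    (is "_ = gts_mor ?A ?B")
proof (intro equalityI subsetI)
  fix f assume "f \<in> lss_mor (X, \<L>) (Y, \<M>)"
  then have fE: "f \<in> X \<rightarrow>\<^sub>E Y" and bd: "bounded_map (X, \<L>) (Y, \<M>) f"
    and cont: "continuous_lss (X, \<L>) (Y, \<M>) f"
    by (auto simp: lss_mor_def)
  have "(\<lambda>V. f -` V \<inter> X) ` \<V> \<in> EF (compat X \<L>) \<L>" if \<V>: "\<V> \<in> EF (compat Y \<M>) \<M>" for \<V>
    unfolding EF_iff
  proof (intro conjI ballI)
    show "(\<lambda>V. f -` V \<inter> X) ` \<V> \<subseteq> compat X \<L>"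
      using \<V> vimage_compat[OF lX bd cont] by (auto simp: EF_iff)
    fix L assume "L \<in> \<L>"
    with bd obtain M where "M \<in> \<M>" "L \<subseteq> f -` M \<inter> X"
      by (auto simp: bounded_map_def)
    then show "essentially_finite_on ((\<lambda>V. f -` V \<inter> X) ` \<V>) L"
      using \<V> by (intro essentially_finite_on_vimage[of _ M]) (auto simp: EF_iff)
  qed
  then show "f \<in> gts_mor ?A ?B"
    using fE by (simp add: gts_mor_def strictly_continuous_def)
next
  fix f assume f: "f \<in> gts_mor ?A ?B"
  then have fE: "f \<in> X \<rightarrow>\<^sub>E Y"
    by (simp add: gts_mor_def)
  have pre: "(\<lambda>M. f -` M \<inter> X) ` \<M> \<in> EF (compat X \<L>) \<L>"
    using f smops_admissible[OF lY] by (auto simp: gts_mor_def strictly_continuous_def)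
  then have "continuous_lss (X, \<L>) (Y, \<M>) f"
    by (auto simp: continuous_lss_def EF_iff)
  moreover have "bounded_map (X, \<L>) (Y, \<M>) f"
    unfolding bounded_map_def
  proof
    fix L assume L: "L \<in> snd (X, \<L>)"
    then have "L \<subseteq> X"
      using lX by (auto simp: locally_small_space_def)
    have "essentially_finite_on ((\<lambda>M. f -` M \<inter> X) ` \<M>) L"
      using pre L by (simp add: EF_iff)
    then obtain \<G> where \<G>: "finite \<G>" "\<G> \<subseteq> (\<lambda>M. f -` M \<inter> X) ` \<M>"
        "(\<Union>M\<in>\<M>. f -` M \<inter> X) \<inter> L \<subseteq> \<Union>\<G>"
      by (rule essentially_finite_onE)
    then obtain \<F> where \<F>: "finite \<F>" "\<F> \<subseteq> \<M>" "\<G> = (\<lambda>M. f -` M \<inter> X) ` \<F>"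
      by (meson finite_subset_image)
    have "x \<in> f -` \<Union>\<F> \<inter> X" if "x \<in> L" for x
    proof -
      have "x \<in> X"
        using \<open>L \<subseteq> X\<close> that by blast
      then have "f x \<in> \<Union>\<M>"
        using fE lY unfolding locally_small_space_def by (metis PiE_mem)
      then have "x \<in> (\<Union>M\<in>\<M>. f -` M \<inter> X) \<inter> L"
        using \<open>x \<in> X\<close> that by auto
      then have "x \<in> \<Union>\<G>"
        using \<G>(3) by (rule set_mp[rotated])
      then show ?thesis
        using \<F>(3) by auto
    qed
    then have "L \<subseteq> f -` \<Union>\<F> \<inter> X"
      by blast
    then show "\<exists>M\<in>snd (Y, \<M>). L \<subseteq> f -` M \<inter> fst (X, \<L>)"
      using locally_small_finite_Union[OF lY \<F>(1,2)] by auto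
  qed
  ultimately show "f \<in> lss_mor (X, \<L>) (Y, \<M>)"
    using fE by (simp add: lss_mor_def)
qed

text \<open>
  The family \<open>\<L>'\<close> covers \<open>X\<close>, so its essential finiteness on \<open>L\<close> places \<open>L\<close> inside a member
  \<open>M\<close> of \<open>\<L>'\<close>, and \<open>L = L \<inter> M\<close> is then in \<open>\<L>'\<close> because \<open>L\<close> is in \<open>\<L>\<^sup>o = \<L>'\<^sup>o\<close>.
\<close>

lemma EF_determines_smops_subset:
  assumes ls: "locally_small_space X \<L>" and ls': "locally_small_space X \<L>'"
    and op: "compat X \<L> = compat X \<L>'" and cov: "EF (compat X \<L>) \<L> = EF (compat X \<L>') \<L>'"
  shows "\<L> \<subseteq> \<L>'"
proof
  fix L assume L: "L \<in> \<L>"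
  have "\<L>' \<in> EF (compat X \<L>) \<L>"
    using smops_admissible[OF ls'] cov by simp
  then have "essentially_finite_on \<L>' L"
    using L by (simp add: EF_iff)
  then obtain \<F> where \<F>: "finite \<F>" "\<F> \<subseteq> \<L>'" "\<Union>\<L>' \<inter> L \<subseteq> \<Union>\<F>"
    by (rule essentially_finite_onE)
  have "L \<subseteq> \<Union>\<L>'"
    using L ls ls' by (auto simp: locally_small_space_def)
  then have "L \<inter> \<Union>\<F> = L"
    using \<F>(3) by blast
  moreover have "L \<in> compat X \<L>'"
    using L smops_subset_compat[OF ls] op by auto
  ultimately show "L \<in> \<L>'"
    using locally_small_finite_Union[OF ls' \<F>(1,2)] by (metis compat_iff)
qed

lemma EF_determines_smops:
  assumes "locally_small_space X \<L>" "locally_small_space X \<L>'"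
    and "compat X \<L> = compat X \<L>'" "EF (compat X \<L>) \<L> = EF (compat X \<L>') \<L>'"
  shows "\<L> = \<L>'"
  using EF_determines_smops_subset[OF assms]
    EF_determines_smops_subset[OF assms(2,1) assms(3,4)[symmetric]] by (rule equalityI)

section \<open>Small generalized topological spaces\<close>

lemma gen_top_space_empty_in_Op: "gen_top_space X Op Cov \<Longrightarrow> {} \<in> Op"
  unfolding gen_top_space_def by (metis Union_empty empty_subsetI finite.emptyI)

lemma gen_top_space_space_in_Op: "gen_top_space X Op Cov \<Longrightarrow> X \<in> Op"
  unfolding gen_top_space_def by (metis Inter_empty Int_UNIV_right empty_subsetI finite.emptyI)

lemma locally_small_Op:
  assumes "gen_top_space X Op Cov"
  shows "locally_small_space X Op"
proof -
  have fin: "\<Union>\<U> \<in> Op \<and> X \<inter> \<Inter>\<U> \<in> Op" if "\<U> \<subseteq> Op" "finite \<U>" for \<U>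
    using assms that by (simp add: gen_top_space_def)
  have sub: "Op \<subseteq> Pow X"
    using assms by (simp add: gen_top_space_def)
  have "L \<inter> M \<in> Op \<and> L \<union> M \<in> Op" if "L \<in> Op" "M \<in> Op" for L M
  proof -
    have "X \<inter> \<Inter>{L, M} = L \<inter> M"
      using sub that by auto
    then show ?thesis
      using fin[of "{L, M}"] that by auto
  qed
  then show ?thesis
    using sub gen_top_space_empty_in_Op[OF assms] gen_top_space_space_in_Op[OF assms]
    by (auto simp: locally_small_space_def)
qed

text \<open>
  The finite subfamily that witnesses essential finiteness is admissible, and saturation
  enlarges it to the whole family.
\<close>

lemma EssFin_subset_Cov:
  assumes "gen_top_space X Op Cov"
  shows "EssFin X Op \<subseteq> Cov"
proof
  fix \<W> assume \<W>: "\<W> \<in> EssFin X Op"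
  then have "\<W> \<subseteq> Op" "essentially_finite_on \<W> X"
    by (auto simp: EssFin_def EF_iff)
  then obtain \<F> where \<F>: "finite \<F>" "\<F> \<subseteq> \<W>" "\<Union>\<W> \<inter> X \<subseteq> \<Union>\<F>"
    by (auto elim: essentially_finite_onE)
  have "Op \<subseteq> Pow X"
    using assms by (simp add: gen_top_space_def)
  with \<open>\<W> \<subseteq> Op\<close> have "\<Union>\<W> \<subseteq> X"
    by blast
  then have "\<Union>\<F> = \<Union>\<W>" "\<forall>U\<in>\<F>. \<exists>V\<in>\<W>. U \<subseteq> V"
    using \<F> by blast+
  moreover have "\<F> \<in> Cov"
    using assms \<F>(1,2) \<open>\<W> \<subseteq> Op\<close> by (simp add: gen_top_space_def)
  moreover have "\<forall>\<U>\<in>Cov. \<forall>\<V>. \<V> \<subseteq> Op \<and> \<Union>\<U> = \<Union>\<V> \<and> (\<forall>U\<in>\<U>. \<exists>V\<in>\<V>. U \<subseteq> V) \<longrightarrow> \<V> \<in> Cov"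
    using assms unfolding gen_top_space_def by (elim conjE)
  ultimately show "\<W> \<in> Cov"
    using \<open>\<W> \<subseteq> Op\<close> by blast
qed

lemma small_gts_Cov:
  assumes "gen_top_space X Op Cov" "small_gts (X, Op, Cov)"
  shows "Cov = EssFin X Op"
proof
  have "Cov \<subseteq> Pow Op"
    using assms(1) by (simp add: gen_top_space_def)
  then show "Cov \<subseteq> EssFin X Op"
    using assms(2) by (auto simp: small_gts_def EssFin_def EF_iff)
qed (rule EssFin_subset_Cov[OF assms(1)])

lemma gen_top_space_EssFin:
  assumes "locally_small_space X \<L>" "X \<in> \<L>"
  shows "gen_top_space X \<L> (EssFin X \<L>)"
  using gen_top_space_EF[OF assms(1)] compat_small[OF assms] EF_small[OF assms] by simp

lemma small_gts_EssFin: "small_gts (X, Op, EssFin X Op)"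
  by (auto simp: small_gts_def EssFin_def EF_iff)

text \<open>
  Openness of preimages is strict continuity for one-element families; preimages of
  essentially finite families are essentially finite for any map.
\<close>

lemma gts_mor_EssFin:
  assumes X: "gen_top_space X Op Cov" and Y: "gen_top_space Y Op' Cov'"
    and f: "f \<in> gts_mor (X, Op, Cov) (Y, Op', Cov')"
  shows "f \<in> gts_mor (X, Op, EssFin X Op) (Y, Op', EssFin Y Op')"
proof -
  have fE: "f \<in> X \<rightarrow>\<^sub>E Y"
    and sc: "\<And>\<V>. \<V> \<in> Cov' \<Longrightarrow> (\<lambda>V. f -` V \<inter> X) ` \<V> \<in> Cov"
    using f by (auto simp: gts_mor_def strictly_continuous_def)
  have op: "f -` V \<inter> X \<in> Op" if "V \<in> Op'" for V
  proof -
    have "{V} \<in> Cov'"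
      using Y that by (simp add: gen_top_space_def)
    then have "{f -` V \<inter> X} \<in> Cov"
      using sc[of "{V}"] by simp
    moreover have "Cov \<subseteq> Pow Op"
      using X by (simp add: gen_top_space_def)
    ultimately show ?thesis
      by blast
  qed
  have "X \<subseteq> f -` Y"
    using fE by auto
  then have "(\<lambda>V. f -` V \<inter> X) ` \<V> \<in> EssFin X Op" if "\<V> \<in> EssFin Y Op'" for \<V>
    using that op essentially_finite_on_vimage[of \<V> Y X X f] by (auto simp: EssFin_def EF_iff)
  then show ?thesis
    using fE by (simp add: gts_mor_def strictly_continuous_def)
qed

section \<open>The categories\<close>

lemma vimage_compose:
  "f \<in> X \<rightarrow> Y \<Longrightarrow> compose X g f -` V \<inter> X = f -` (g -` V \<inter> Y) \<inter> X"
  by (auto simp: compose_def)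

lemma is_category_GTS: "is_category GTS"
proof -
  have id: "id_map X \<in> gts_mor (X, Op, Cov) (X, Op, Cov)" if "gen_top_space X Op Cov"
    for X :: "'a set" and Op Cov
  proof -
    have "Op \<subseteq> Pow X" "Cov \<subseteq> Pow Op"
      using that by (simp_all add: gen_top_space_def)
    have "(\<lambda>V. id_map X -` V \<inter> X) ` \<V> = \<V>" if "\<V> \<in> Cov" for \<V>
    proof -
      have "id_map X -` V \<inter> X = V" if "V \<in> \<V>" for V
      proof -
        have "V \<subseteq> X"
          using \<open>Op \<subseteq> Pow X\<close> \<open>Cov \<subseteq> Pow Op\<close> \<open>\<V> \<in> Cov\<close> that by blast
        then show ?thesis by (auto simp: id_map_def)
      qed
      then show ?thesis by simp
    qed
    then show ?thesis
      by (auto simp: gts_mor_def strictly_continuous_def id_map_def)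
  qed
  have comp: "compose (fst A) g f \<in> gts_mor A D" if "f \<in> gts_mor A B" "g \<in> gts_mor B D"
    for A B D :: "'a gts" and f g
  proof -
    have fE: "f \<in> fst A \<rightarrow>\<^sub>E fst B" and gE: "g \<in> fst B \<rightarrow>\<^sub>E fst D"
      using that by (auto simp: gts_mor_def)
    have "(\<lambda>V. compose (fst A) g f -` V \<inter> fst A) ` \<V>
        = (\<lambda>V. f -` V \<inter> fst A) ` (\<lambda>V. g -` V \<inter> fst B) ` \<V>" for \<V>
      using fE by (auto simp: image_image vimage_compose[of f _ "fst B"] PiE_def)
    moreover have "compose (fst A) g f \<in> fst A \<rightarrow>\<^sub>E fst D"
      using fE gE by (auto simp: compose_def)
    ultimately show ?thesis
      using that by (auto simp: gts_mor_def strictly_continuous_def)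
  qed
  show ?thesis
    unfolding is_category_def GTS_def using id comp by (auto simp: gts_mor_def)
qed

lemma is_category_full_subcat: "is_category C \<Longrightarrow> is_category (full_subcat C P)"
  by (auto simp: is_category_def full_subcat_def)

text \<open>
  Since bounded continuous maps are exactly the strictly continuous maps of the associated
  generalized topological spaces, the category axioms are inherited from \<open>GTS\<close>.
\<close>

lemma is_category_LSS: "is_category LSS"
proof -
  let ?I = "\<lambda>A :: 'a lss. ob_map ident_LSS A"
  have ob: "?I A \<in> Ob GTS" if "A \<in> Ob LSS" for A
    using that gen_top_space_EF by (auto simp: LSS_def GTS_def ident_LSS_def)
  have mor: "Mor LSS A B = Mor GTS (?I A) (?I B)" if "A \<in> Ob LSS" "B \<in> Ob LSS" for A B
    using that by (cases A; cases B) (simp add: LSS_def GTS_def ident_LSS_def lss_mor_eq_gts_mor)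
  have und: "Und LSS A = Und GTS (?I A)" for A
    by (simp add: LSS_def GTS_def ident_LSS_def split: prod.split)
  show ?thesis
    using is_category_GTS[where 'a = 'a] ob unfolding is_category_def
    by (simp add: mor und) blast
qed

lemma is_category_SS: "is_category SS"
  by (simp add: SS_def is_category_full_subcat is_category_LSS)

lemma is_category_SS_GTS: "is_category SS_GTS"
  by (simp add: SS_GTS_def is_category_full_subcat is_category_GTS)

lemma Ob_LSS_iff: "(X, \<L>) \<in> Ob LSS \<longleftrightarrow> locally_small_space X \<L>"
  by (simp add: LSS_def)

lemma Ob_SS_iff: "(X, \<L>) \<in> Ob SS \<longleftrightarrow> locally_small_space X \<L> \<and> X \<in> \<L>"
  by (simp add: SS_def full_subcat_def LSS_def small_lss_def)

lemma Ob_GTS_iff: "(X, Op, Cov) \<in> Ob GTS \<longleftrightarrow> gen_top_space X Op Cov"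
  by (simp add: GTS_def)

lemma Ob_SS_GTS_iff:
  "(X, Op, Cov) \<in> Ob SS_GTS \<longleftrightarrow> gen_top_space X Op Cov \<and> small_gts (X, Op, Cov)"
  by (simp add: SS_GTS_def full_subcat_def GTS_def)

lemma construct_sel:
  "Und LSS = fst" "Und SS = fst" "Und GTS = fst" "Und SS_GTS = fst"
  "Mor LSS = lss_mor" "Mor SS = lss_mor" "Mor GTS = gts_mor" "Mor SS_GTS = gts_mor"
  by (simp_all add: LSS_def SS_def GTS_def SS_GTS_def full_subcat_def)

lemma is_functor_identity_on_maps:
  assumes "is_category C" "is_category D"
    and "\<And>A. A \<in> Ob C \<Longrightarrow> ob_map F A \<in> Ob D"
    and "\<And>A. A \<in> Ob C \<Longrightarrow> Und D (ob_map F A) = Und C A"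
    and "\<And>A B f. A \<in> Ob C \<Longrightarrow> B \<in> Ob C \<Longrightarrow> f \<in> Mor C A B \<Longrightarrow> f \<in> Mor D (ob_map F A) (ob_map F B)"
    and "mor_map F = (\<lambda>A B f. f)"
  shows "is_functor C D F"
  using assms by (simp add: is_functor_def)

section \<open>Smallification\<close>

lemma sm_LSS_simps: "ob_map sm_LSS (X, \<L>) = (X, compat X \<L>)" "mor_map sm_LSS = (\<lambda>A B f. f)"
  by (simp_all add: sm_LSS_def)

lemma ident_LSS_simps:
  "ob_map ident_LSS (X, \<L>) = (X, compat X \<L>, EF (compat X \<L>) \<L>)"
  "mor_map ident_LSS = (\<lambda>A B f. f)"
  by (simp_all add: ident_LSS_def)

lemma ident_SS_simps:
  "ob_map ident_SS (X, \<L>) = (X, \<L>, EssFin X \<L>)" "mor_map ident_SS = (\<lambda>A B f. f)"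
  by (simp_all add: ident_SS_def)

lemma sm_GTS_simps:
  "ob_map sm_GTS (X, Op, Cov) = (X, Op, EssFin X Op)" "mor_map sm_GTS = (\<lambda>A B f. f)"
  by (simp_all add: sm_GTS_def)

lemma sm_LSS_Ob: "A \<in> Ob LSS \<Longrightarrow> ob_map sm_LSS A \<in> Ob SS"
  by (cases A) (simp add: Ob_LSS_iff Ob_SS_iff sm_LSS_simps locally_small_compat compat_space)

lemma is_functor_sm_LSS: "is_functor LSS SS sm_LSS"
proof (rule is_functor_identity_on_maps[OF is_category_LSS is_category_SS sm_LSS_Ob])
  fix A B :: "'a lss" and f
  assume "A \<in> Ob LSS" "B \<in> Ob LSS" "f \<in> Mor LSS A B"
  then show "f \<in> Mor SS (ob_map sm_LSS A) (ob_map sm_LSS B)"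
    by (cases A; cases B) (simp add: Ob_LSS_iff construct_sel sm_LSS_simps lss_mor_compat)
qed (auto simp: construct_sel sm_LSS_def)

lemma concrete_reflector_sm_LSS: "concrete_reflector LSS SS sm_LSS"
proof -
  have "subcategory SS (LSS :: ('a lss, 'a) construct)"
    by (auto simp: subcategory_def is_category_LSS is_category_SS construct_sel)
      (simp add: Ob_LSS_iff Ob_SS_iff)
  moreover have "Und SS (ob_map sm_LSS A) = Und LSS A \<and>
      is_reflection LSS SS A (ob_map sm_LSS A) (id_map (Und LSS A))"
    if A: "A \<in> Ob LSS" for A :: "'a lss"
  proof (cases A)
    case (Pair X \<L>)
    with A have lX: "locally_small_space X \<L>"
      by (simp add: Ob_LSS_iff)
    have "\<exists>!g. g \<in> lss_mor (X, compat X \<L>) B \<and> compose X g (id_map X) = f"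
      if "B \<in> Ob SS" "f \<in> lss_mor (X, \<L>) B" for B and f :: "'a \<Rightarrow> 'a"
    proof (cases B)
      case (Pair Y \<M>)
      then show ?thesis
        using that smallification_universal[OF lX, of Y \<M> f] by (simp add: Ob_SS_iff)
    qed
    then show ?thesis
      using Pair sm_LSS_Ob[OF A] id_map_mor_compat[OF lX]
      by (simp add: is_reflection_def construct_sel sm_LSS_simps)
  qed
  moreover have "compose (Und LSS A) (mor_map sm_LSS A B f) (id_map (Und LSS A))
      = compose (Und LSS A) (id_map (Und LSS B)) f"
    if "f \<in> Mor LSS A B" for A B :: "'a lss" and f
  proof -
    have "f \<in> fst A \<rightarrow>\<^sub>E fst B"
      using that by (simp add: construct_sel lss_mor_def)
    then show ?thesis
      by (simp add: construct_sel sm_LSS_simps compose_id_map compose_id_map_left PiE_def)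
  qed
  ultimately show ?thesis
    by (simp add: concrete_reflector_def is_functor_sm_LSS)
qed

lemma full_embedding_ident_LSS: "full_embedding LSS GTS ident_LSS"
proof -
  have ob: "ob_map ident_LSS A \<in> Ob GTS" if "A \<in> Ob LSS" for A :: "'a lss"
    using that by (cases A) (simp add: Ob_LSS_iff Ob_GTS_iff ident_LSS_simps gen_top_space_EF)
  have mor: "Mor LSS A B = Mor GTS (ob_map ident_LSS A) (ob_map ident_LSS B)"
    if "A \<in> Ob LSS" "B \<in> Ob LSS" for A B :: "'a lss"
    using that
    by (cases A; cases B) (simp add: Ob_LSS_iff construct_sel ident_LSS_simps lss_mor_eq_gts_mor)
  have "is_functor LSS (GTS :: ('a gts, 'a) construct) ident_LSS"
  proof (rule is_functor_identity_on_maps[OF is_category_LSS is_category_GTS ob])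
    show "Und GTS (ob_map ident_LSS A) = Und LSS A" for A :: "'a lss"
      by (cases A) (simp add: construct_sel ident_LSS_simps)
  qed (simp_all add: mor ident_LSS_simps)
  moreover have "inj_on (ob_map ident_LSS) (Ob (LSS :: ('a lss, 'a) construct))"
    by (auto simp: inj_on_def Ob_LSS_iff ident_LSS_simps dest: EF_determines_smops)
  ultimately show ?thesis
    by (simp add: full_embedding_def mor ident_LSS_simps bij_betw_def)
qed

lemma ident_LSS_eq_ident_SS: "A \<in> Ob SS \<Longrightarrow> ob_map ident_LSS A = ob_map ident_SS A"
  by (cases A) (metis EF_small Ob_SS_iff compat_small ident_LSS_simps(1) ident_SS_simps(1))

lemma cat_isomorphism_ident_SS: "cat_isomorphism SS SS_GTS ident_SS"
proof -
  have ob: "ob_map ident_SS A \<in> Ob SS_GTS" if "A \<in> Ob SS" for A :: "'a lss"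
    using that by (cases A)
      (simp add: Ob_SS_iff Ob_SS_GTS_iff ident_SS_simps gen_top_space_EssFin small_gts_EssFin)
  have mor: "Mor SS A B = Mor SS_GTS (ob_map ident_SS A) (ob_map ident_SS B)"
    if "A \<in> Ob SS" "B \<in> Ob SS" for A B :: "'a lss"
  proof -
    have "lss_mor A B = gts_mor (ob_map ident_LSS A) (ob_map ident_LSS B)"
      using that by (cases A; cases B) (simp add: Ob_SS_iff ident_LSS_simps lss_mor_eq_gts_mor)
    then show ?thesis
      using that by (simp add: construct_sel ident_LSS_eq_ident_SS)
  qed
  have "is_functor SS (SS_GTS :: ('a gts, 'a) construct) ident_SS"
  proof (rule is_functor_identity_on_maps[OF is_category_SS is_category_SS_GTS ob])
    show "Und SS_GTS (ob_map ident_SS A) = Und SS A" for A :: "'a lss"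
      by (cases A) (simp add: construct_sel ident_SS_simps)
  qed (simp_all add: mor ident_SS_simps)
  moreover have "inj_on (ob_map ident_SS) (Ob (SS :: ('a lss, 'a) construct))"
    by (auto simp: inj_on_def ident_SS_simps)
  ultimately have emb: "full_embedding SS (SS_GTS :: ('a gts, 'a) construct) ident_SS"
    by (simp add: full_embedding_def mor ident_SS_simps bij_betw_def)
  have "A \<in> ob_map ident_SS ` Ob SS" if "A \<in> Ob SS_GTS" for A :: "'a gts"
  proof (cases A)
    case (fields X Op Cov)
    with that have gts: "gen_top_space X Op Cov" and small: "small_gts (X, Op, Cov)"
      by (auto simp: Ob_SS_GTS_iff)
    have "(X, Op) \<in> Ob SS"
      by (simp add: Ob_SS_iff locally_small_Op[OF gts] gen_top_space_space_in_Op[OF gts])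
    moreover have "A = ob_map ident_SS (X, Op)"
      using fields small_gts_Cov[OF gts small] by (simp add: ident_SS_simps)
    ultimately show ?thesis by blast
  qed
  with emb ob show ?thesis
    by (auto simp: cat_isomorphism_def)
qed

lemma is_functor_sm_GTS: "is_functor GTS SS_GTS sm_GTS"
proof (rule is_functor_identity_on_maps[OF is_category_GTS is_category_SS_GTS])
  show "ob_map sm_GTS A \<in> Ob SS_GTS" if "A \<in> Ob GTS" for A :: "'a gts"
  proof (cases A)
    case (fields X Op Cov)
    with that have gts: "gen_top_space X Op Cov"
      by (simp add: Ob_GTS_iff)
    show ?thesis
      using gen_top_space_EssFin[OF locally_small_Op[OF gts] gen_top_space_space_in_Op[OF gts]]
      by (simp add: fields sm_GTS_simps Ob_SS_GTS_iff small_gts_EssFin)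
  qed
  fix A B :: "'a gts" and f
  assume "A \<in> Ob GTS" "B \<in> Ob GTS" "f \<in> Mor GTS A B"
  then show "f \<in> Mor SS_GTS (ob_map sm_GTS A) (ob_map sm_GTS B)"
    by (cases A; cases B) (auto simp: Ob_GTS_iff construct_sel sm_GTS_simps intro: gts_mor_EssFin)
qed (auto simp: construct_sel sm_GTS_def)

theorem theorem2p70:
  shows
    "(concrete_reflector (LSS :: ('a lss, 'a) construct) SS sm_LSS \<and>
      (\<forall>A\<in>Ob (LSS :: ('a lss, 'a) construct). \<forall>B\<in>Ob (SS :: ('b lss, 'b) construct).
         \<forall>f\<in>lss_mor A B.
           \<exists>!g. g \<in> lss_mor (ob_map sm_LSS A) B \<and> compose (fst A) g (id_map (fst A)) = f)) \<and>
     (full_embedding (LSS :: ('a lss, 'a) construct) GTS ident_LSS \<and>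
      cat_isomorphism (SS :: ('a lss, 'a) construct) SS_GTS ident_SS \<and>
      functors_eq_on (SS :: ('a lss, 'a) construct) ident_LSS ident_SS \<and>
      is_functor (GTS :: ('a gts, 'a) construct) SS_GTS sm_GTS \<and>
      functors_eq_on (LSS :: ('a lss, 'a) construct)
        (fctr_comp sm_GTS ident_LSS) (fctr_comp ident_SS sm_LSS))"
proof (intro conjI ballI)
  fix A :: "'a lss" and B :: "'b lss" and f
  assume "A \<in> Ob LSS" "B \<in> Ob SS" "f \<in> lss_mor A B"
  moreover obtain X \<L> Y \<M> where "A = (X, \<L>)" "B = (Y, \<M>)"
    by fastforce
  ultimately show "\<exists>!g. g \<in> lss_mor (ob_map sm_LSS A) B \<and> compose (fst A) g (id_map (fst A)) = f"
    using smallification_universal[of X \<L> Y \<M> f]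
    by (simp add: Ob_LSS_iff Ob_SS_iff sm_LSS_simps)
next
  show "functors_eq_on (SS :: ('a lss, 'a) construct) ident_LSS ident_SS"
    by (simp add: functors_eq_on_def ident_LSS_eq_ident_SS ident_LSS_simps ident_SS_simps)
  show "functors_eq_on (LSS :: ('a lss, 'a) construct)
      (fctr_comp sm_GTS ident_LSS) (fctr_comp ident_SS sm_LSS)"
    by (auto simp: functors_eq_on_def fctr_comp_def sm_GTS_simps ident_LSS_simps ident_SS_simps
        sm_LSS_simps)
qed (rule concrete_reflector_sm_LSS full_embedding_ident_LSS cat_isomorphism_ident_SS
    is_functor_sm_GTS)+

end
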